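(* Let $K$ be a field, let $I$ be a monomial ideal in the polynomial ring $K[x_1,\ldots,x_n]$, and let $u$ be a monomial which is a non-zerodivisor modulo $I$. Then $I$ is of linear type if and only if $(I,u)$ is of linear type.
   Context: All rings are commutative with unit. For a Noetherian ring $R$ and an ideal $I=(f_1,\ldots,f_m)\subseteq R$, let $\mathcal{R}(I)=R[f_1t,\ldots,f_mt]\subseteq R[t]$ be the Rees algebra, $T=R[y_1,\ldots,y_m]$ a polynomial ring, $\varphi:T\to\mathcal{R}(I)$ the $R$-algebra homomorphism with $\varphi(y_j)=f_jt$, and $J=\ker\varphi$. Let $L\subseteq J$ be the ideal of $T$ generated by all linear relations $\sum_{i=1}^m a_iy_i$ with $a_i\in R$ and $\sum_i a_if_i=0$. The ideal $I$ is of linear type if $J=L$, equivalently if the canonical epimorphism from the symmetric algebra $S(I)\cong T/L$ to $\mathcal{R}(I)$ is an isomorphism. $(I,u)$ denotes the ideal generated by $I$ and $u$.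
   Formalization: The monomial u is assumed different from 1: for u = 1 the claim fails, e.g. I = (x^2, xy, y^2) is not of linear type, while 1 is a non-zerodivisor modulo I and (I,1) is the whole ring, which is of linear type. *)

theory Defs
  imports "HOL-Library.Poly_Mapping" "HOL-Computational_Algebra.Polynomial"
begin

text \<open>Multivariate polynomials are finitely supported maps from exponent vectors to coefficients;
  \<open>Poly_Mapping\<close> supplies the convolution product. For finite \<open>'v\<close> with \<open>n\<close> elements
  this is the polynomial ring in \<open>n\<close> variables.\<close>

type_synonym ('v, 'a) mpoly = "('v \<Rightarrow>\<^sub>0 nat) \<Rightarrow>\<^sub>0 'a"

definition ideal_gen :: "'a::comm_ring_1 set \<Rightarrow> 'a set" where
  "ideal_gen A = module.span (*) A"

lemma module_times: "module ((*) :: 'a::comm_ring_1 \<Rightarrow> 'a \<Rightarrow> 'a)"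
  by unfold_locales (simp_all add: algebra_simps)

text \<open>The ideal generated by \<open>A\<close> in a subring \<open>T\<close> of the ambient ring, for \<open>A \<subseteq> T\<close>:
  coefficients are taken from \<open>T\<close> only.\<close>

definition ideal_gen_in :: "'a::comm_ring_1 set \<Rightarrow> 'a set \<Rightarrow> 'a set" where
  "ideal_gen_in T A =
    {\<Sum>a\<in>S. c a * a | S c. finite S \<and> S \<subseteq> A \<and> (\<forall>a\<in>S. c a \<in> T)}"

text \<open>The ring \<open>T = R[y\<^sub>0, \<dots>, y\<^bsub>m-1\<^esub>]\<close>, as a subring of the polynomial ring over \<open>R\<close> in
  countably many variables, so that \<open>m\<close> can vary. Variables are numbered from 0.\<close>

definition poly_ring :: "nat \<Rightarrow> (nat, 'a::comm_ring_1) mpoly set" where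
  "poly_ring m = {F. \<forall>e\<in>Poly_Mapping.keys F. Poly_Mapping.keys e \<subseteq> {..<m}}"

definition var :: "nat \<Rightarrow> (nat, 'a::comm_ring_1) mpoly" where
  "var j = Poly_Mapping.single (Poly_Mapping.single j 1) 1"

definition const :: "'a::comm_ring_1 \<Rightarrow> (nat, 'a) mpoly" where
  "const a = Poly_Mapping.single 0 a"

text \<open>The \<open>R\<close>-algebra homomorphism from \<open>T\<close> to \<open>R[t]\<close> with \<open>y\<^sub>j \<mapsto> f\<^sub>j t\<close>, for the generators
  \<open>fs = [f\<^sub>0, \<dots>, f\<^bsub>m-1\<^esub>]\<close>; its image is the Rees algebra. It is only meaningful on
  \<open>poly_ring (length fs)\<close>.\<close>

definition rees_map :: "'a::comm_ring_1 list \<Rightarrow> (nat, 'a) mpoly \<Rightarrow> 'a poly" where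
  "rees_map fs F =
    (\<Sum>e\<in>Poly_Mapping.keys F.
       [:Poly_Mapping.lookup F e:]
         * (\<Prod>j\<in>Poly_Mapping.keys e. monom (fs ! j) 1 ^ Poly_Mapping.lookup e j))"

definition rees_ideal :: "'a::comm_ring_1 list \<Rightarrow> (nat, 'a) mpoly set" where
  "rees_ideal fs = {F \<in> poly_ring (length fs). rees_map fs F = 0}"

definition linear_relations :: "'a::comm_ring_1 list \<Rightarrow> (nat, 'a) mpoly set" where
  "linear_relations fs =
    {\<Sum>i<length fs. const (a i) * var i | a. (\<Sum>i<length fs. a i * fs ! i) = 0}"

text \<open>The equality \<open>J = L\<close> does not depend on the chosen finite generating system of \<open>I\<close>: it says
  that the canonical map from the symmetric algebra of \<open>I\<close> to the Rees algebra of \<open>I\<close> is injective.\<close>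

definition linear_type :: "'a::comm_ring_1 set \<Rightarrow> bool" where
  "linear_type I \<longleftrightarrow>
    (\<exists>fs. I = ideal_gen (set fs) \<and>
          rees_ideal fs = ideal_gen_in (poly_ring (length fs)) (linear_relations fs))"

definition is_monomial :: "('v, 'k::field) mpoly \<Rightarrow> bool" where
  "is_monomial u \<longleftrightarrow> (\<exists>e. u = Poly_Mapping.single e 1)"

definition monomial_ideal :: "('v, 'k::field) mpoly set \<Rightarrow> bool" where
  "monomial_ideal I \<longleftrightarrow> (\<exists>M. (\<forall>v\<in>M. is_monomial v) \<and> I = ideal_gen M)"

definition nonzerodivisor_mod :: "'a::comm_ring_1 set \<Rightarrow> 'a \<Rightarrow> bool" where
  "nonzerodivisor_mod I u \<longleftrightarrow> (\<forall>g. u * g \<in> I \<longrightarrow> g \<in> I)"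

end

theory Submission
  imports Defs
begin

text \<open>The variables of \<open>u\<close> can be stripped from the monomials of \<open>I\<close> because \<open>u\<close> is regular modulo
  \<open>I\<close>, so \<open>I\<close> has monomial generators \<open>f\<^sub>0, \<dots>, f\<^bsub>m-1\<^esub>\<close> coprime to \<open>u\<close>. Then division by \<open>u\<close>,
  \<open>p = \<nu> p + u q(p)\<close>, where \<open>\<nu>\<close> drops the multiples of \<open>u\<close>, is compatible with multiplication by
  the \<open>f\<^sub>i\<close>. Let \<open>z\<close> be the variable sent to \<open>u t\<close>.

  Suppose \<open>I\<close> is of linear type and \<open>F = H(y) + z G(y, z)\<close> lies in the kernel for \<open>(I, u)\<close>. Reducing
  modulo \<open>u\<close>, the remainder \<open>\<nu> H\<close> lies in the kernel for \<open>I\<close>, hence is generated by linear relations.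
  The quotient part \<open>u q(H)\<close> is turned into a multiple of \<open>z\<close> by the relations \<open>u y\<^sub>j - f\<^sub>j z\<close>, so
  that \<open>F\<close> is congruent to \<open>z F'\<close> with \<open>F'\<close> in the kernel and of smaller degree.

  Conversely, if \<open>F(y)\<close> is in the kernel for \<open>I\<close>, then \<open>\<nu> F\<close> is a combination of linear relations for
  \<open>(I, u)\<close>; setting \<open>z\<close> to \<open>0\<close> and applying \<open>\<nu>\<close> yields linear relations for \<open>I\<close>. Then
  one continues with \<open>q(F)\<close>.\<close>

abbreviation lookup :: "('a \<Rightarrow>\<^sub>0 'b::zero) \<Rightarrow> 'a \<Rightarrow> 'b" where "lookup \<equiv> Poly_Mapping.lookup"
abbreviation keys :: "('a \<Rightarrow>\<^sub>0 'b::zero) \<Rightarrow> 'a set" where "keys \<equiv> Poly_Mapping.keys"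
abbreviation single :: "'a \<Rightarrow> 'b \<Rightarrow> 'a \<Rightarrow>\<^sub>0 'b::zero" where "single \<equiv> Poly_Mapping.single"

section \<open>Ideals\<close>

lemma ideal_gen_base: "a \<in> A \<Longrightarrow> a \<in> ideal_gen A"
  and ideal_gen_zero: "0 \<in> ideal_gen A"
  and ideal_gen_add: "x \<in> ideal_gen A \<Longrightarrow> y \<in> ideal_gen A \<Longrightarrow> x + y \<in> ideal_gen A"
  and ideal_gen_diff: "x \<in> ideal_gen A \<Longrightarrow> y \<in> ideal_gen A \<Longrightarrow> x - y \<in> ideal_gen A"
  and ideal_gen_mult: "x \<in> ideal_gen A \<Longrightarrow> c * x \<in> ideal_gen A"
  and ideal_gen_sum: "(\<And>i. i \<in> S \<Longrightarrow> f i \<in> ideal_gen A) \<Longrightarrow> sum f S \<in> ideal_gen A"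
  and ideal_gen_mono: "A \<subseteq> B \<Longrightarrow> ideal_gen A \<subseteq> ideal_gen B"
  and ideal_gen_idem: "ideal_gen (ideal_gen A) = ideal_gen A"
  unfolding ideal_gen_def
  by (fact module.span_base[OF module_times] module.span_zero[OF module_times]
      module.span_add[OF module_times] module.span_diff[OF module_times]
      module.span_scale[OF module_times] module.span_sum[OF module_times]
      module.span_mono[OF module_times] module.span_span[OF module_times])+

lemma ideal_gen_least: "A \<subseteq> ideal_gen B \<Longrightarrow> ideal_gen A \<subseteq> ideal_gen B"
  using ideal_gen_mono ideal_gen_idem by metis

lemma ideal_gen_induct [consumes 1, case_names zero add]:
  assumes "x \<in> ideal_gen A" "P 0"
    and "\<And>c a y. a \<in> A \<Longrightarrow> y \<in> ideal_gen A \<Longrightarrow> P y \<Longrightarrow> P (c * a + y)"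
  shows "P x"
proof -
  have "x \<in> ideal_gen A \<and> P x"
    using assms(1) unfolding ideal_gen_def
  proof (induction rule: module.span_induct_alt[OF module_times, consumes 1, case_names zero add])
    case zero
    then show ?case using ideal_gen_zero assms(2) by (auto simp: ideal_gen_def)
  next
    case (add c a y)
    then show ?case
      using assms(3) ideal_gen_add[OF ideal_gen_mult[OF ideal_gen_base]]
      by (auto simp: ideal_gen_def)
  qed
  then show ?thesis by simp
qed

lemma sum_delta_mult:
  fixes x :: "nat \<Rightarrow> 'a::semiring_0"
  shows "j < n \<Longrightarrow> (\<Sum>i<n. (if i = j then c else 0) * x i) = c * x j"
  by (simp add: if_distrib[of "\<lambda>c. c * _"] cong: if_cong)

lemma ideal_gen_set_coeffs:
  assumes "x \<in> ideal_gen (set fs)"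
  obtains c where "x = (\<Sum>i<length fs. c i * fs ! i)"
proof -
  have "\<exists>c. x = (\<Sum>i<length fs. c i * fs ! i)"
    using assms
  proof (induction rule: ideal_gen_induct)
    case zero
    show ?case by (rule exI[of _ "\<lambda>_. 0"]) simp
  next
    case (add r a y)
    then obtain c k where c: "y = (\<Sum>i<length fs. c i * fs ! i)" and k: "k < length fs" "a = fs ! k"
      by (metis in_set_conv_nth)
    show ?case
      by (intro exI[of _ "\<lambda>i. (if i = k then r else 0) + c i"])
        (simp add: c k sum_delta_mult distrib_right sum.distrib)
  qed
  then show thesis using that by blast
qed

text \<open>Each element of the ideal is a combination of finitely many elements of
  \<open>A\<close>. This later cuts a possibly infinite set of monomial generators down to a finite
  one.\<close>

lemma ideal_gen_finite_subset:
  assumes "finite X" "X \<subseteq> ideal_gen A"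
  obtains S where "finite S" "S \<subseteq> A" "X \<subseteq> ideal_gen S"
proof -
  have one: "\<exists>S. finite S \<and> S \<subseteq> A \<and> x \<in> ideal_gen S" if "x \<in> ideal_gen A" for x
    using that
  proof (induction rule: ideal_gen_induct)
    case zero
    then show ?case using ideal_gen_zero by blast
  next
    case (add c a y)
    then obtain S where S: "finite S" "S \<subseteq> A" "y \<in> ideal_gen S" by blast
    have "c * a + y \<in> ideal_gen (insert a S)"
      using S(3) ideal_gen_mono[of S "insert a S"]
      by (blast intro: ideal_gen_add ideal_gen_mult ideal_gen_base)
    with S add(1) show ?case by (intro exI[of _ "insert a S"]) auto
  qed
  then obtain S where S: "\<And>x. x \<in> ideal_gen A \<Longrightarrow> finite (S x) \<and> S x \<subseteq> A \<and> x \<in> ideal_gen (S x)"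
    by metis
  show thesis
  proof (rule that[of "\<Union>(S ` X)"])
    show "X \<subseteq> ideal_gen (\<Union>(S ` X))"
      using S assms(2) ideal_gen_mono[of "S _" "\<Union>(S ` X)"] by blast
  qed (use S assms in auto)
qed

section \<open>Ring homomorphisms out of the polynomial ring\<close>

locale unital_ring_hom =
  fixes h :: "'a::comm_ring_1 \<Rightarrow> 'b::comm_ring_1"
  assumes hom_one: "h 1 = 1"
    and hom_add: "h (x + y) = h x + h y"
    and hom_mult: "h (x * y) = h x * h y"
begin

lemma hom_zero: "h 0 = 0"
  using hom_add[of 0 0] by simp

lemma hom_sum: "h (sum f S) = (\<Sum>i\<in>S. h (f i))"
  by (induction S rule: infinite_finite_induct) (auto simp: hom_zero hom_add)

lemma hom_uminus: "h (- x) = - h x"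
  using hom_add[of x "- x"] by (simp add: hom_zero eq_neg_iff_add_eq_0 add.commute)

lemma hom_diff: "h (x - y) = h x - h y"
  using hom_add[of x "- y"] by (simp add: hom_uminus)

lemma hom_ideal_gen:
  assumes "x \<in> ideal_gen A" "\<And>a. a \<in> A \<Longrightarrow> h a \<in> ideal_gen B"
  shows "h x \<in> ideal_gen B"
  using assms(1)
  by (induction rule: ideal_gen_induct)
    (auto simp: hom_zero hom_add hom_mult intro: ideal_gen_zero ideal_gen_add ideal_gen_mult assms(2))

end

lemma poly_mapping_eq_sum_single:
  fixes f :: "'a \<Rightarrow>\<^sub>0 'b::comm_monoid_add"
  shows "f = (\<Sum>k\<in>keys f. single k (lookup f k))"
proof (rule poly_mapping_eqI)
  fix k
  have "(\<Sum>x\<in>keys f. lookup f x when x = k) = (\<Sum>x\<in>keys f. if x = k then lookup f x else 0)"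
    by (rule sum.cong) auto
  then show "lookup f k = lookup (\<Sum>k\<in>keys f. single k (lookup f k)) k"
    by (auto simp: lookup_sum lookup_single in_keys_iff)
qed

text \<open>The term case may assume \<open>k \<in> keys f\<close>, so that bounds on the support of
  \<open>f\<close>, such as membership in \<open>poly_ring m\<close>, remain available for each
  term.\<close>

lemma poly_mapping_single_induct [case_names zero single add]:
  fixes f :: "'a \<Rightarrow>\<^sub>0 'b::comm_monoid_add"
  assumes "P 0" "\<And>k c. k \<in> keys f \<Longrightarrow> P (single k c)" "\<And>f g. P f \<Longrightarrow> P g \<Longrightarrow> P (f + g)"
  shows "P f"
proof -
  have "P (\<Sum>k\<in>S. single k (lookup f k))" if "finite S" "S \<subseteq> keys f" for S
    using that by (induction S rule: finite_induct) (auto intro: assms)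
  from this[of "keys f"] show ?thesis
    using poly_mapping_eq_sum_single[of f] by simp
qed

definition power_product :: "(nat \<Rightarrow> 'b::comm_ring_1) \<Rightarrow> (nat \<Rightarrow>\<^sub>0 nat) \<Rightarrow> 'b" where
  "power_product s e = (\<Prod>j\<in>keys e. s j ^ lookup e j)"

lemma power_product_superset:
  "finite S \<Longrightarrow> keys e \<subseteq> S \<Longrightarrow> power_product s e = (\<Prod>j\<in>S. s j ^ lookup e j)"
  unfolding power_product_def by (rule prod.mono_neutral_left) (auto simp: in_keys_iff)

lemma power_product_add: "power_product s (e + e') = power_product s e * power_product s e'"
proof -
  let ?S = "keys e \<union> keys e'"
  show ?thesis
    using keys_add[of e e']
    by (simp add: power_product_superset[of ?S] lookup_add power_add prod.distrib)
qed

lemma power_product_zero [simp]: "power_product s 0 = 1"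
  by (simp add: power_product_def)

lemma power_product_single [simp]: "power_product s (single j n) = s j ^ n"
  by (cases "n = 0") (simp_all add: power_product_def)

text \<open>For a ring homomorphism \<open>h\<close> this is the map from the universal property of
  the polynomial ring; \<open>rees_map\<close> and all substitutions are instances.\<close>

definition eval_poly :: "('a \<Rightarrow> 'b) \<Rightarrow> (nat \<Rightarrow> 'b) \<Rightarrow> (nat, 'a::comm_ring_1) mpoly \<Rightarrow> 'b::comm_ring_1" where
  "eval_poly h s F = (\<Sum>e\<in>keys F. h (lookup F e) * power_product s e)"

context unital_ring_hom
begin

lemma eval_poly_superset:
  "finite S \<Longrightarrow> keys F \<subseteq> S \<Longrightarrow> eval_poly h s F = (\<Sum>e\<in>S. h (lookup F e) * power_product s e)"
  unfolding eval_poly_def by (rule sum.mono_neutral_left) (auto simp: in_keys_iff hom_zero)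

lemma eval_poly_single: "eval_poly h s (single e c) = h c * power_product s e"
  by (cases "c = 0") (simp_all add: eval_poly_def hom_zero)

lemma eval_poly_zero: "eval_poly h s 0 = 0"
  by (simp add: eval_poly_def)

lemma eval_poly_add: "eval_poly h s (F + G) = eval_poly h s F + eval_poly h s G"
proof -
  let ?S = "keys F \<union> keys G"
  show ?thesis
    using keys_add[of F G]
    by (simp add: eval_poly_superset[of ?S] lookup_add hom_add distrib_right sum.distrib)
qed

lemma eval_poly_mult: "eval_poly h s (F * G) = eval_poly h s F * eval_poly h s G"
proof (induction F rule: poly_mapping_single_induct)
  case (single e c)
  show ?case
    by (induction G rule: poly_mapping_single_induct)
      (simp_all add: mult_single eval_poly_single eval_poly_zero eval_poly_add hom_mult
        power_product_add algebra_simps)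
qed (simp_all add: eval_poly_zero eval_poly_add distrib_right)

lemma unital_ring_hom_eval_poly: "unital_ring_hom (eval_poly h s)"
  by unfold_locales
    (simp_all add: eval_poly_add eval_poly_mult eval_poly_single hom_one flip: single_one)

lemma eval_poly_const: "eval_poly h s (const a) = h a"
  by (simp add: const_def eval_poly_single)

lemma eval_poly_var: "eval_poly h s (var j) = s j"
  by (simp add: var_def eval_poly_single hom_one)

end

section \<open>Constants, variables and the subrings \<open>poly_ring m\<close>\<close>

lemma unital_ring_hom_const: "unital_ring_hom const"
  by unfold_locales (simp_all add: const_def single_add mult_single)

lemma const_zero [simp]: "const 0 = 0" and const_one [simp]: "const 1 = 1"
  by (simp_all add: const_def)

lemma lookup_const_mult: "lookup (const c * F) e = c * lookup F e"
  by (simp add: const_def Poly_Mapping.map.rep_eq when_def flip: mult_map_scale_conv_mult)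

lemma zero_in_poly_ring: "0 \<in> poly_ring m"
  by (simp add: poly_ring_def)

lemma const_in_poly_ring: "const a \<in> poly_ring m"
  by (auto simp: poly_ring_def const_def split: if_splits)

lemma var_in_poly_ring: "j < m \<Longrightarrow> var j \<in> poly_ring m"
  by (auto simp: poly_ring_def var_def)

lemma add_in_poly_ring: "F \<in> poly_ring m \<Longrightarrow> G \<in> poly_ring m \<Longrightarrow> F + G \<in> poly_ring m"
  using keys_add[of F G] by (auto simp: poly_ring_def)

lemma mult_in_poly_ring:
  assumes "F \<in> poly_ring m" "G \<in> poly_ring m"
  shows "F * G \<in> poly_ring m"
  unfolding poly_ring_def
proof (intro CollectI ballI)
  fix e assume "e \<in> keys (F * G)"
  then obtain a b where "a \<in> keys F" "b \<in> keys G" "e = a + b"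
    using keys_mult[of F G] by blast
  then show "keys e \<subseteq> {..<m}"
    using assms keys_add[of a b] unfolding poly_ring_def by blast
qed

lemma sum_in_poly_ring: "(\<And>i. i \<in> S \<Longrightarrow> F i \<in> poly_ring m) \<Longrightarrow> sum F S \<in> poly_ring m"
  by (induction S rule: infinite_finite_induct) (auto intro: zero_in_poly_ring add_in_poly_ring)

lemma poly_ring_mono: "m \<le> n \<Longrightarrow> poly_ring m \<subseteq> poly_ring n"
  by (force simp: poly_ring_def)

lemma poly_ring_induct [consumes 1, case_names const var add mult]:
  assumes F: "F \<in> poly_ring m"
    and const: "\<And>a. P (const a)"
    and var: "\<And>j. j < m \<Longrightarrow> P (var j)"
    and add: "\<And>F G. P F \<Longrightarrow> P G \<Longrightarrow> P (F + G)"
    and mult: "\<And>F G. P F \<Longrightarrow> P G \<Longrightarrow> P (F * G)"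
  shows "P F"
proof (induction F rule: poly_mapping_single_induct)
  case zero
  show ?case using const[of 0] by simp
next
  case (single e c)
  then have e: "keys e \<subseteq> {..<m}" using F by (auto simp: poly_ring_def)
  have power: "P (single (single j n) 1)" if "j < m" for j n
  proof (induction n)
    case 0
    show ?case using const[of 1] by simp
  next
    case (Suc n)
    have "single (single j (Suc n)) 1 = var j * single (single j n) (1::'a)"
      by (simp add: var_def mult_single flip: single_add)
    then show ?case using Suc var[OF that] mult by simp
  qed
  have "P (single (\<Sum>j\<in>S. single j (lookup e j)) 1)" if "finite S" "S \<subseteq> {..<m}" for S
    using that
  proof (induction S rule: finite_induct)
    case empty
    show ?case using const[of 1] by simp
  next
    case (insert j S)
    then have "single (\<Sum>j\<in>insert j S. single j (lookup e j)) (1::'a) =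
        single (single j (lookup e j)) 1 * single (\<Sum>j\<in>S. single j (lookup e j)) 1"
      by (simp add: mult_single)
    then show ?case using insert power mult by simp
  qed
  from this[of "keys e"] have "P (single e 1)"
    using e poly_mapping_eq_sum_single[of e] by simp
  from mult[OF const[of c] this] show ?case
    by (simp add: const_def mult_single)
qed (rule add)

lemma obtain_poly_ring:
  fixes F :: "(nat, 'a::comm_ring_1) mpoly"
  obtains m where "F \<in> poly_ring m"
proof -
  have "finite (\<Union>(keys ` keys F))" by simp
  then obtain m where "\<forall>j\<in>\<Union>(keys ` keys F). j < m"
    using finite_nat_set_iff_bounded by blast
  then show thesis using that[of m] by (auto simp: poly_ring_def)
qed

lemma mpoly_induct [case_names const var add mult]:
  assumes "\<And>a. P (const a)" "\<And>j. P (var j)" "\<And>F G. P F \<Longrightarrow> P G \<Longrightarrow> P (F + G)"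
    "\<And>F G. P F \<Longrightarrow> P G \<Longrightarrow> P (F * G)"
  shows "P F"
proof -
  obtain m where "F \<in> poly_ring m" by (rule obtain_poly_ring)
  then show ?thesis by (induction rule: poly_ring_induct) (auto intro: assms)
qed

lemma unital_ring_hom_eqI:
  assumes "unital_ring_hom h" "unital_ring_hom k" "F \<in> poly_ring m"
    and "\<And>a. h (const a) = k (const a)" "\<And>j. j < m \<Longrightarrow> h (var j) = k (var j)"
  shows "h F = k F"
  using assms(3)
  by (induction rule: poly_ring_induct)
    (simp_all add: assms unital_ring_hom.hom_add[OF assms(1)] unital_ring_hom.hom_add[OF assms(2)]
      unital_ring_hom.hom_mult[OF assms(1)] unital_ring_hom.hom_mult[OF assms(2)])

lemma unital_ring_hom_id: "unital_ring_hom (\<lambda>x. x)"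
  by unfold_locales simp_all

lemma unital_ring_hom_comp:
  "unital_ring_hom h \<Longrightarrow> unital_ring_hom k \<Longrightarrow> unital_ring_hom (\<lambda>x. k (h x))"
  by (simp add: unital_ring_hom_def)

text \<open>The congruence passes to products because \<open>h F * h G - k F * k G\<close>
  telescopes into multiples of the two single differences. It serves to compare a composite of
  substitutions with the identity.\<close>

lemma unital_ring_hom_cong_ideal:
  assumes h: "unital_ring_hom h" and k: "unital_ring_hom k"
    and "F \<in> poly_ring m"
    and "\<And>a. h (const a) - k (const a) \<in> ideal_gen B" "\<And>j. j < m \<Longrightarrow> h (var j) - k (var j) \<in> ideal_gen B"
  shows "h F - k F \<in> ideal_gen B"
  using assms(3)
proof (induction rule: poly_ring_induct)
  case (add F G)
  then show ?case
    using ideal_gen_add[OF add]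
    by (simp add: unital_ring_hom.hom_add[OF h] unital_ring_hom.hom_add[OF k] algebra_simps)
next
  case (mult F G)
  have "h (F * G) - k (F * G) = h F * (h G - k G) + k G * (h F - k F)"
    by (simp add: unital_ring_hom.hom_mult[OF h] unital_ring_hom.hom_mult[OF k] algebra_simps)
  then show ?case using mult by (simp add: ideal_gen_add ideal_gen_mult)
qed (use assms in auto)

abbreviation substitute :: "(nat \<Rightarrow> (nat, 'a::comm_ring_1) mpoly) \<Rightarrow> (nat, 'a) mpoly \<Rightarrow> (nat, 'a) mpoly" where
  "substitute \<equiv> eval_poly const"

lemmas unital_ring_hom_substitute = unital_ring_hom.unital_ring_hom_eval_poly[OF unital_ring_hom_const]
lemmas substitute_simps =
  unital_ring_hom.eval_poly_const[OF unital_ring_hom_const]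
  unital_ring_hom.eval_poly_var[OF unital_ring_hom_const]
  unital_ring_hom.hom_zero[OF unital_ring_hom_substitute]
  unital_ring_hom.hom_add[OF unital_ring_hom_substitute]
  unital_ring_hom.hom_mult[OF unital_ring_hom_substitute]
  unital_ring_hom.hom_sum[OF unital_ring_hom_substitute]

lemma substitute_eq_self:
  assumes "F \<in> poly_ring m" "\<And>j. j < m \<Longrightarrow> s j = var j"
  shows "substitute s F = F"
  by (rule unital_ring_hom_eqI[OF unital_ring_hom_substitute unital_ring_hom_id assms(1)])
    (simp_all add: substitute_simps assms(2))

lemma substitute_in_poly_ring:
  assumes "F \<in> poly_ring m" "\<And>j. j < m \<Longrightarrow> s j \<in> poly_ring n"
  shows "substitute s F \<in> poly_ring n"
  using assms(1)
  by (induction rule: poly_ring_induct)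
    (simp_all add: substitute_simps assms(2) const_in_poly_ring add_in_poly_ring mult_in_poly_ring)

section \<open>Linear relations and the choice of generators\<close>

text \<open>Setting the variables from \<open>m\<close> on to 0 fixes \<open>x\<close> and the
  elements of \<open>A\<close> and moves arbitrary coefficients into \<open>poly_ring m\<close>. The
  relative ideal can then be handled through \<open>ideal_gen\<close> in the ambient ring.\<close>

lemma ideal_gen_in_poly_ring:
  fixes A :: "(nat, 'a::comm_ring_1) mpoly set"
  assumes "A \<subseteq> poly_ring m"
  shows "ideal_gen_in (poly_ring m) A = poly_ring m \<inter> ideal_gen A"
proof (intro equalityI subsetI IntI)
  fix x assume "x \<in> ideal_gen_in (poly_ring m) A"
  then obtain S c where x: "x = (\<Sum>a\<in>S. c a * a)" and "S \<subseteq> A" "\<forall>a\<in>S. c a \<in> poly_ring m"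
    unfolding ideal_gen_in_def by blast
  then show "x \<in> poly_ring m"
    using assms unfolding x by (intro sum_in_poly_ring mult_in_poly_ring) auto
  show "x \<in> ideal_gen A"
    using \<open>S \<subseteq> A\<close> unfolding x by (intro ideal_gen_sum ideal_gen_mult ideal_gen_base) auto
next
  fix x assume x: "x \<in> poly_ring m \<inter> ideal_gen A"
  then obtain S c where S: "finite S" "S \<subseteq> A" and sum: "x = (\<Sum>a\<in>S. c a * a)"
    unfolding ideal_gen_def module.span_explicit[OF module_times] by blast
  let ?t = "substitute (\<lambda>j. if j < m then var j else 0)"
  have fixed: "?t F = F" if "F \<in> poly_ring m" for F
    using that by (rule substitute_eq_self) simp
  have "x = ?t x" by (rule fixed[symmetric]) (use x in simp)
  also have "\<dots> = (\<Sum>a\<in>S. ?t (c a) * a)"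
    unfolding sum using S assms by (auto simp: substitute_simps fixed intro!: sum.cong)
  finally have eq: "x = (\<Sum>a\<in>S. ?t (c a) * a)" .
  have "?t G \<in> poly_ring m" for G :: "(nat, 'a) mpoly"
    by (induction G rule: mpoly_induct)
      (simp_all add: substitute_simps const_in_poly_ring var_in_poly_ring zero_in_poly_ring
        add_in_poly_ring mult_in_poly_ring)
  with S eq show "x \<in> ideal_gen_in (poly_ring m) A"
    unfolding ideal_gen_in_def by (intro CollectI exI[of _ S] exI[of _ "\<lambda>a. ?t (c a)"]) auto
qed

definition linear_form :: "nat \<Rightarrow> (nat \<Rightarrow> 'a::comm_ring_1) \<Rightarrow> (nat, 'a) mpoly" where
  "linear_form n a = (\<Sum>i<n. const (a i) * var i)"

lemma linear_form_in_poly_ring: "linear_form n a \<in> poly_ring n"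
  unfolding linear_form_def
  by (intro sum_in_poly_ring mult_in_poly_ring const_in_poly_ring var_in_poly_ring) auto

lemma linear_form_delta: "j < n \<Longrightarrow> linear_form n (\<lambda>i. if i = j then a else 0) = const a * var j"
  unfolding linear_form_def if_distrib[of const] const_zero by (rule sum_delta_mult)

lemma linear_form_diff: "linear_form n (\<lambda>i. a i - b i) = linear_form n a - linear_form n b"
  by (simp add: linear_form_def unital_ring_hom.hom_diff[OF unital_ring_hom_const]
      left_diff_distrib sum_subtractf)

lemma linear_relations_eq:
  "linear_relations fs = {linear_form (length fs) a | a. (\<Sum>i<length fs. a i * fs ! i) = 0}"
  by (simp add: linear_relations_def linear_form_def)

lemma linear_relation_in_ideal:
  "(\<Sum>i<length fs. a i * fs ! i) = 0 \<Longrightarrow> linear_form (length fs) a \<in> ideal_gen (linear_relations fs)"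
  by (auto simp: linear_relations_eq intro: ideal_gen_base)

section \<open>The Rees map and its kernel\<close>

lemma unital_ring_hom_pCons: "unital_ring_hom (\<lambda>a. [:a:])"
  by unfold_locales (simp_all add: one_pCons)

lemma rees_map_eq_eval_poly: "rees_map fs = eval_poly (\<lambda>a. [:a:]) (\<lambda>j. monom (fs ! j) 1)"
  by (rule ext) (simp add: rees_map_def eval_poly_def power_product_def)

lemma unital_ring_hom_rees_map: "unital_ring_hom (rees_map fs)"
  unfolding rees_map_eq_eval_poly
  by (rule unital_ring_hom.unital_ring_hom_eval_poly[OF unital_ring_hom_pCons])

lemma rees_map_const [simp]: "rees_map fs (const a) = [:a:]"
  and rees_map_var [simp]: "rees_map fs (var j) = monom (fs ! j) 1"
  unfolding rees_map_eq_eval_poly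
  by (simp_all add: unital_ring_hom.eval_poly_const[OF unital_ring_hom_pCons]
      unital_ring_hom.eval_poly_var[OF unital_ring_hom_pCons])

lemmas rees_map_simps =
  unital_ring_hom.hom_zero[OF unital_ring_hom_rees_map]
  unital_ring_hom.hom_add[OF unital_ring_hom_rees_map]
  unital_ring_hom.hom_diff[OF unital_ring_hom_rees_map]
  unital_ring_hom.hom_mult[OF unital_ring_hom_rees_map]
  unital_ring_hom.hom_sum[OF unital_ring_hom_rees_map]

lemma sum_monom: "(\<Sum>i\<in>S. monom (f i) n) = monom (\<Sum>i\<in>S. f i) n"
  by (induction S rule: infinite_finite_induct) (auto simp: add_monom)

lemma rees_map_linear_form: "rees_map fs (linear_form n a) = monom (\<Sum>i<n. a i * fs ! i) 1"
  by (simp add: linear_form_def rees_map_simps smult_monom sum_monom)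

lemma rees_map_linear_relations:
  assumes "F \<in> ideal_gen (linear_relations fs)"
  shows "rees_map fs F = 0"
  using assms
  by (induction rule: ideal_gen_induct)
    (auto simp: rees_map_simps linear_relations_eq rees_map_linear_form)

text \<open>Only the inclusion of J in L for the generators \<open>fs\<close>; the reverse inclusion
  always holds by \<open>rees_map_linear_relations\<close>.\<close>

definition rees_kernel_linear :: "'a::comm_ring_1 list \<Rightarrow> bool" where
  "rees_kernel_linear fs \<longleftrightarrow>
    (\<forall>F\<in>poly_ring (length fs). rees_map fs F = 0 \<longrightarrow> F \<in> ideal_gen (linear_relations fs))"

lemma linear_type_iff_ex_rees_kernel_linear:
  "linear_type I \<longleftrightarrow> (\<exists>fs. I = ideal_gen (set fs) \<and> rees_kernel_linear fs)"
proof -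
  have "rees_ideal fs = ideal_gen_in (poly_ring (length fs)) (linear_relations fs) \<longleftrightarrow>
      rees_kernel_linear fs" for fs :: "'a list"
  proof -
    have "linear_relations fs \<subseteq> poly_ring (length fs)"
      by (auto simp: linear_relations_eq linear_form_in_poly_ring)
    then show ?thesis
      using rees_map_linear_relations[of _ fs]
      by (auto simp: ideal_gen_in_poly_ring rees_kernel_linear_def rees_ideal_def)
  qed
  then show ?thesis by (simp add: linear_type_def)
qed

text \<open>Expressing the generators in terms of each other gives substitutions in both directions;
  they respect the two Rees maps, and their composition is the identity modulo linear relations.\<close>

lemma rees_kernel_linear_change_generators:
  assumes gen: "ideal_gen (set fs) = ideal_gen (set gs)" and fs: "rees_kernel_linear fs"
  shows "rees_kernel_linear gs"
proof -
  let ?m = "length fs" and ?n = "length gs"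
  have "\<exists>c. gs ! j = (\<Sum>i<?m. c i * fs ! i)" if "j < ?n" for j
    by (rule ideal_gen_set_coeffs[of "gs ! j" fs]) (use that gen ideal_gen_base[OF nth_mem[OF that]] in auto)
  then obtain c where c: "\<And>j. j < ?n \<Longrightarrow> gs ! j = (\<Sum>i<?m. c j i * fs ! i)" by metis
  have "\<exists>d. fs ! i = (\<Sum>j<?n. d j * gs ! j)" if "i < ?m" for i
    by (rule ideal_gen_set_coeffs[of "fs ! i" gs]) (use that gen ideal_gen_base[OF nth_mem[OF that]] in auto)
  then obtain d where d: "\<And>i. i < ?m \<Longrightarrow> fs ! i = (\<Sum>j<?n. d i j * gs ! j)" by metis
  define \<alpha> where "\<alpha> = substitute (\<lambda>j. linear_form ?m (c j))"
  define \<beta> where "\<beta> = substitute (\<lambda>i. linear_form ?n (d i))"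
  have hom: "unital_ring_hom \<alpha>" "unital_ring_hom \<beta>"
    unfolding \<alpha>_def \<beta>_def by (rule unital_ring_hom_substitute)+
  have \<beta>_linear: "\<beta> (linear_form ?m a) = linear_form ?n (\<lambda>j. \<Sum>i<?m. a i * d i j)" for a
  proof -
    have "\<beta> (linear_form ?m a) = (\<Sum>i<?m. \<Sum>j<?n. const (a i * d i j) * var j)"
      by (simp add: \<beta>_def linear_form_def substitute_simps sum_distrib_left
          unital_ring_hom.hom_mult[OF unital_ring_hom_const] mult.assoc)
    also have "\<dots> = (\<Sum>j<?n. \<Sum>i<?m. const (a i * d i j) * var j)"
      by (rule sum.swap)
    finally show ?thesis
      by (simp add: linear_form_def unital_ring_hom.hom_sum[OF unital_ring_hom_const] sum_distrib_right)
  qed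
  \<comment> \<open>This shows that \<open>\<beta>\<close> sends relations of \<open>fs\<close> to
    relations of \<open>gs\<close>. With \<open>a = c j\<close> it also evaluates the coefficients
    of \<open>\<beta> (\<alpha> (var j))\<close> on \<open>gs\<close>.\<close>
  have sum_d: "(\<Sum>j<?n. (\<Sum>i<?m. a i * d i j) * gs ! j) = (\<Sum>i<?m. a i * fs ! i)" for a
  proof -
    have "(\<Sum>j<?n. (\<Sum>i<?m. a i * d i j) * gs ! j) = (\<Sum>j<?n. \<Sum>i<?m. a i * d i j * gs ! j)"
      by (simp add: sum_distrib_right)
    also have "\<dots> = (\<Sum>i<?m. \<Sum>j<?n. a i * d i j * gs ! j)"
      by (rule sum.swap)
    finally show ?thesis
      by (simp add: d sum_distrib_left mult.assoc)
  qed
  show ?thesis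
    unfolding rees_kernel_linear_def
  proof (intro ballI impI)
    fix F assume F: "F \<in> poly_ring ?n" and "rees_map gs F = 0"
    have "rees_map fs (\<alpha> F) = rees_map gs F"
      by (rule unital_ring_hom_eqI[OF unital_ring_hom_comp[OF hom(1) unital_ring_hom_rees_map]
            unital_ring_hom_rees_map F])
        (simp_all add: \<alpha>_def substitute_simps rees_map_linear_form c)
    with \<open>rees_map gs F = 0\<close> fs have "\<alpha> F \<in> ideal_gen (linear_relations fs)"
      unfolding rees_kernel_linear_def \<alpha>_def
      using substitute_in_poly_ring[OF F linear_form_in_poly_ring] by auto
    then have 1: "\<beta> (\<alpha> F) \<in> ideal_gen (linear_relations gs)"
      by (rule unital_ring_hom.hom_ideal_gen[OF hom(2)])
        (auto simp: linear_relations_eq[of fs] \<beta>_linear sum_d intro!: linear_relation_in_ideal)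
    have "\<beta> (\<alpha> F) - F \<in> ideal_gen (linear_relations gs)"
    proof (rule unital_ring_hom_cong_ideal[OF unital_ring_hom_comp[OF hom] unital_ring_hom_id F])
      fix a show "\<beta> (\<alpha> (const a)) - const a \<in> ideal_gen (linear_relations gs)"
        by (simp add: \<alpha>_def \<beta>_def substitute_simps ideal_gen_zero)
    next
      fix j assume j: "j < ?n"
      let ?\<delta> = "\<lambda>k. if k = j then 1 else 0"
      \<comment> \<open>These are the coefficients of
        \<open>\<beta> (\<alpha> (var j)) - var j\<close>; evaluated on \<open>gs\<close> they give
        \<open>gs ! j - gs ! j\<close>.\<close>
      have "linear_form ?n (\<lambda>k. (\<Sum>i<?m. c j i * d i k) - ?\<delta> k) \<in> ideal_gen (linear_relations gs)"
        by (rule linear_relation_in_ideal)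
          (simp add: left_diff_distrib sum_subtractf sum_d sum_delta_mult[OF j] c[OF j])
      moreover have "\<beta> (\<alpha> (var j)) = linear_form ?n (\<lambda>k. \<Sum>i<?m. c j i * d i k)"
        by (simp add: \<alpha>_def substitute_simps \<beta>_linear)
      ultimately show "\<beta> (\<alpha> (var j)) - var j \<in> ideal_gen (linear_relations gs)"
        by (simp add: linear_form_diff linear_form_delta[OF j])
    qed
    from ideal_gen_diff[OF 1 this] show "F \<in> ideal_gen (linear_relations gs)"
      by simp
  qed
qed

lemma linear_type_iff_rees_kernel_linear:
  "linear_type (ideal_gen (set fs)) \<longleftrightarrow> rees_kernel_linear fs"
  unfolding linear_type_iff_ex_rees_kernel_linear
  using rees_kernel_linear_change_generators by blast

section \<open>Total degree\<close>

definition total_degree :: "('v \<Rightarrow>\<^sub>0 nat) \<Rightarrow> nat" where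
  "total_degree e = (\<Sum>j\<in>keys e. lookup e j)"

lemma total_degree_superset: "finite S \<Longrightarrow> keys e \<subseteq> S \<Longrightarrow> total_degree e = (\<Sum>j\<in>S. lookup e j)"
  unfolding total_degree_def by (rule sum.mono_neutral_left) (auto simp: in_keys_iff)

lemma total_degree_add: "total_degree (e + e') = total_degree e + total_degree e'"
proof -
  let ?S = "keys e \<union> keys e'"
  show ?thesis
    using keys_add[of e e'] by (simp add: total_degree_superset[of ?S] lookup_add sum.distrib)
qed

lemma total_degree_single [simp]: "total_degree (single j n) = n"
  by (cases "n = 0") (simp_all add: total_degree_def)

text \<open>The bound is strict, so that \<open>d = 0\<close> leaves only the zero polynomial as the
  base case of the induction on degree.\<close>

definition poly_ring_below :: "nat \<Rightarrow> nat \<Rightarrow> (nat, 'a::comm_ring_1) mpoly set" where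
  "poly_ring_below d m = {F \<in> poly_ring m. \<forall>e\<in>keys F. total_degree e < d}"

lemma poly_ring_below_subset: "F \<in> poly_ring_below d m \<Longrightarrow> F \<in> poly_ring m"
  by (simp add: poly_ring_below_def)

lemma poly_ring_below_mono: "m \<le> n \<Longrightarrow> F \<in> poly_ring_below d m \<Longrightarrow> F \<in> poly_ring_below d n"
  using poly_ring_mono by (auto simp: poly_ring_below_def)

lemma zero_in_poly_ring_below: "0 \<in> poly_ring_below d m"
  by (simp add: poly_ring_below_def zero_in_poly_ring)

lemma add_in_poly_ring_below:
  "F \<in> poly_ring_below d m \<Longrightarrow> G \<in> poly_ring_below d m \<Longrightarrow> F + G \<in> poly_ring_below d m"
  using keys_add[of F G] by (auto simp: poly_ring_below_def add_in_poly_ring)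

lemma sum_in_poly_ring_below:
  "(\<And>i. i \<in> S \<Longrightarrow> F i \<in> poly_ring_below d m) \<Longrightarrow> sum F S \<in> poly_ring_below d m"
  by (induction S rule: infinite_finite_induct)
    (auto intro: zero_in_poly_ring_below add_in_poly_ring_below)

lemma keys_subset_in_poly_ring_below:
  "F \<in> poly_ring_below d m \<Longrightarrow> keys G \<subseteq> keys F \<Longrightarrow> G \<in> poly_ring_below d m"
  by (auto simp: poly_ring_below_def poly_ring_def)

lemma const_mult_in_poly_ring_below:
  assumes "F \<in> poly_ring_below d m"
  shows "const c * F \<in> poly_ring_below d m"
proof (rule keys_subset_in_poly_ring_below[OF assms])
  show "keys (const c * F) \<subseteq> keys F"
    using keys_mult[of "const c" F] by (auto simp: const_def split: if_splits)
qed

text \<open>The terms are sorted by whether variable \<open>m\<close> occurs in them; taking out one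
  factor \<open>var m\<close> lowers the total degree by one.\<close>

lemma poly_ring_below_split_last:
  assumes F: "F \<in> poly_ring_below (Suc d) (Suc m)"
  obtains H G where "F = H + var m * G" "H \<in> poly_ring_below (Suc d) m" "G \<in> poly_ring_below d (Suc m)"
proof -
  have "\<exists>H G. F = H + var m * G \<and> H \<in> poly_ring_below (Suc d) m \<and> G \<in> poly_ring_below d (Suc m)"
  proof (induction F rule: poly_mapping_single_induct)
    case zero
    show ?case
      by (intro exI[of _ 0]) (simp add: zero_in_poly_ring_below)
  next
    case (single e c)
    then have e: "keys e \<subseteq> {..<Suc m}" "total_degree e < Suc d"
      using F by (auto simp: poly_ring_below_def poly_ring_def)
    show ?case
    proof (cases "m \<in> keys e")
      case True
      define e' where "e' = e - single m 1"
      have e': "e = single m 1 + e'"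
        using True unfolding e'_def
        by (intro poly_mapping_eqI)
          (auto simp: lookup_add lookup_minus lookup_single when_def in_keys_iff)
      have "keys e' \<subseteq> keys e"
        by (auto simp: e' in_keys_iff lookup_add)
      moreover have "total_degree e' < d"
        using e(2) unfolding e' by (simp add: total_degree_add)
      ultimately have "single e' c \<in> poly_ring_below d (Suc m)"
        using e(1) by (auto simp: poly_ring_below_def poly_ring_def split: if_splits)
      moreover have "single e c = 0 + var m * single e' c"
        by (simp add: var_def mult_single e')
      ultimately show ?thesis
        using zero_in_poly_ring_below by blast
    next
      case False
      then have "keys e \<subseteq> {..<m}"
        using e(1) less_Suc_eq by auto
      then have "single e c \<in> poly_ring_below (Suc d) m"
        using e(2) by (auto simp: poly_ring_below_def poly_ring_def split: if_splits)
      moreover have "single e c = single e c + var m * 0" by simp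
      ultimately show ?thesis
        using zero_in_poly_ring_below by blast
    qed
  next
    case (add f g)
    then obtain H G H' G' where
      "f = H + var m * G" "H \<in> poly_ring_below (Suc d) m" "G \<in> poly_ring_below d (Suc m)"
      "g = H' + var m * G'" "H' \<in> poly_ring_below (Suc d) m" "G' \<in> poly_ring_below d (Suc m)"
      by blast
    then show ?case
      by (intro exI[of _ "H + H'"] exI[of _ "G + G'"])
        (simp add: add_in_poly_ring_below algebra_simps)
  qed
  then show thesis using that by blast
qed

text \<open>Splitting off the last variable repeatedly assigns each nonconstant term to its highest
  variable.\<close>

lemma poly_ring_below_split:
  assumes "F \<in> poly_ring_below (Suc d) m"
  obtains c P where "F = const c + (\<Sum>j<m. var j * P j)" "\<forall>j<m. P j \<in> poly_ring_below d m"
proof -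
  have "\<exists>c P. F = const c + (\<Sum>j<m. var j * P j) \<and> (\<forall>j<m. P j \<in> poly_ring_below d m)"
    using assms
  proof (induction m arbitrary: F)
    case 0
    then have "keys F \<subseteq> {0}"
      by (auto simp: poly_ring_below_def poly_ring_def)
    then have "F = const (lookup F 0)"
      by (intro poly_mapping_eqI) (auto simp: const_def lookup_single when_def in_keys_iff)
    then show ?case by auto
  next
    case (Suc m)
    obtain H G where F: "F = H + var m * G" and H: "H \<in> poly_ring_below (Suc d) m"
      and G: "G \<in> poly_ring_below d (Suc m)"
      by (rule poly_ring_below_split_last[OF Suc.prems])
    obtain c P where "H = const c + (\<Sum>j<m. var j * P j)" "\<forall>j<m. P j \<in> poly_ring_below d m"
      using Suc.IH[OF H] by blast
    then show ?case
      using F G poly_ring_below_mono[of m "Suc m"]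
      by (intro exI[of _ c] exI[of _ "P(m := G)"]) (auto simp: less_Suc_eq algebra_simps)
  qed
  then show thesis using that by blast
qed

lemma rees_map_single:
  "rees_map gs (single e c) = monom (c * power_product ((!) gs) e) (total_degree e)"
proof -
  have "(\<Prod>j\<in>S. monom (gs ! j) 1 ^ lookup e j) = monom (\<Prod>j\<in>S. gs ! j ^ lookup e j) (\<Sum>j\<in>S. lookup e j)" for S
    by (induction S rule: infinite_finite_induct) (auto simp: monom_power mult_monom)
  then show ?thesis
    unfolding rees_map_eq_eval_poly unital_ring_hom.eval_poly_single[OF unital_ring_hom_pCons]
    by (simp add: power_product_def total_degree_def smult_monom)
qed

section \<open>Adjoining an element along a splitting\<close>

text \<open>The remainder \<open>\<nu>\<close> and the quotient \<open>q\<close> of division by \<open>u\<close>: the remainder is linear over the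
  subring generated by \<open>fs\<close>. For a monomial \<open>u\<close> involving none of the variables of the monomials
  \<open>fs\<close>, \<open>\<nu>\<close> drops the multiples of \<open>u\<close>.\<close>

locale linear_splitting =
  fixes fs :: "'a::comm_ring_1 list" and u :: 'a and \<nu> q :: "'a \<Rightarrow> 'a"
  assumes \<nu>_add: "\<nu> (x + y) = \<nu> x + \<nu> y"
    and split: "x = \<nu> x + u * q x"
    and \<nu>_mult_u: "\<nu> (u * x) = 0"
    and \<nu>_mult_gen: "f \<in> set fs \<Longrightarrow> \<nu> (x * f) = \<nu> x * f"
    and nonzerodivisor: "u * x = 0 \<Longrightarrow> x = 0"
begin

lemma \<nu>_zero [simp]: "\<nu> 0 = 0"
  using \<nu>_add[of 0 0] by simp

lemma \<nu>_idem [simp]: "\<nu> (\<nu> x) = \<nu> x"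
  by (metis \<nu>_add \<nu>_mult_u add.right_neutral split)

lemma \<nu>_sum: "\<nu> (sum f S) = (\<Sum>i\<in>S. \<nu> (f i))"
  by (induction S rule: infinite_finite_induct) (auto simp: \<nu>_add)

lemma q_zero [simp]: "q 0 = 0"
  using split[of 0] nonzerodivisor[of "q 0"] by simp

section \<open>Coefficientwise division by \<open>u\<close>\<close>

abbreviation remainder where "remainder \<equiv> Poly_Mapping.map \<nu>"
abbreviation quotient where "quotient \<equiv> Poly_Mapping.map q"

text \<open>\<open>Poly_Mapping.map\<close> acts on nonzero coefficients only; the formula holds at
  every exponent because \<open>\<nu> 0 = 0\<close>, and likewise for \<open>q\<close>.\<close>

lemma lookup_remainder [simp]: "lookup (remainder F) e = \<nu> (lookup F e)"
  by (simp add: Poly_Mapping.map.rep_eq when_def)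

lemma lookup_quotient [simp]: "lookup (quotient F) e = q (lookup F e)"
  by (simp add: Poly_Mapping.map.rep_eq when_def)

lemma keys_remainder: "keys (remainder F) \<subseteq> keys F"
  by (auto simp: in_keys_iff)

lemma keys_quotient: "keys (quotient F) \<subseteq> keys F"
  by (auto simp: in_keys_iff)

lemma remainder_in_poly_ring: "F \<in> poly_ring m \<Longrightarrow> remainder F \<in> poly_ring m"
  using keys_remainder[of F] by (auto simp: poly_ring_def)

lemma quotient_in_poly_ring: "F \<in> poly_ring m \<Longrightarrow> quotient F \<in> poly_ring m"
  using keys_quotient[of F] by (auto simp: poly_ring_def)

lemma remainder_idem [simp]: "remainder (remainder F) = remainder F"
  by (rule poly_mapping_eqI) simp

lemma remainder_zero [simp]: "remainder 0 = 0"
  by (rule poly_mapping_eqI) simp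

lemma remainder_add: "remainder (F + G) = remainder F + remainder G"
  by (rule poly_mapping_eqI) (simp add: lookup_add \<nu>_add)

lemma remainder_single [simp]: "remainder (single e c) = single e (\<nu> c)"
  by (rule poly_mapping_eqI) (simp add: lookup_single when_def)

lemma remainder_quotient: "F = remainder F + const u * quotient F"
  by (rule poly_mapping_eqI) (simp add: lookup_add lookup_const_mult flip: split)

lemma \<nu>_mult_power_product:
  assumes "keys e \<subseteq> {..<length fs}"
  shows "\<nu> (x * power_product ((!) fs) e) = \<nu> x * power_product ((!) fs) e"
proof -
  have power: "\<nu> (y * f ^ n) = \<nu> y * f ^ n" if "f \<in> set fs" for y f n
    by (induction n) (simp_all add: that \<nu>_mult_gen power_Suc2 flip: mult.assoc del: power_Suc)
  have "\<nu> (x * (\<Prod>j\<in>S. fs ! j ^ lookup e j)) = \<nu> x * (\<Prod>j\<in>S. fs ! j ^ lookup e j)"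
    if "finite S" "S \<subseteq> keys e" for S
    using that
  proof (induction S arbitrary: x rule: finite_induct)
    case (insert j S)
    then show ?case
      using assms by (simp add: power subset_iff flip: mult.assoc)
  qed simp
  then show ?thesis by (simp add: power_product_def)
qed

text \<open>The Rees map multiplies the coefficient of a term by a product of elements of
  \<open>fs\<close>, and \<nu> commutes with such a multiplication.\<close>

lemma coeff_rees_map_remainder:
  assumes "F \<in> poly_ring (length fs)"
  shows "coeff (rees_map fs (remainder F)) n = \<nu> (coeff (rees_map fs F) n)"
proof (induction F rule: poly_mapping_single_induct)
  case (single e c)
  then have "keys e \<subseteq> {..<length fs}" using assms by (auto simp: poly_ring_def)
  then show ?case by (simp add: rees_map_single \<nu>_mult_power_product)
qed (simp_all add: rees_map_simps remainder_add \<nu>_add)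

lemma rees_map_remainder_eq_zero:
  assumes "F \<in> poly_ring (length fs)" "rees_map fs F = [:u:] * p"
  shows "rees_map fs (remainder F) = 0"
  by (rule poly_eqI) (simp add: coeff_rees_map_remainder assms \<nu>_mult_u)

lemma smult_u_eq_zero:
  assumes "[:u:] * p = 0"
  shows "p = 0"
proof (rule poly_eqI)
  fix n
  have "u * coeff p n = coeff ([:u:] * p) n" by simp
  also have "\<dots> = 0" unfolding assms by simp
  finally show "coeff p n = coeff 0 n" using nonzerodivisor by auto
qed

text \<open>Multiples of \<open>u\<close> are killed and multiples of members of \<open>fs\<close>
  stay such. This is what removes \<open>u\<close> from a generating set for elements fixed by
  \<nu>.\<close>

lemma \<nu>_ideal_gen:
  assumes "x \<in> ideal_gen (insert u (set fs))"
  shows "\<nu> x \<in> ideal_gen (set fs)"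
  using assms
proof (induction rule: ideal_gen_induct)
  case (add c a y)
  have "\<nu> (c * a) \<in> ideal_gen (set fs)"
    using add.hyps(1) by (auto simp: \<nu>_mult_gen \<nu>_mult_u mult.commute[of c u]
        intro: ideal_gen_zero ideal_gen_mult[OF ideal_gen_base])
  with add.IH show ?case by (simp add: \<nu>_add ideal_gen_add)
qed (simp add: ideal_gen_zero)

section \<open>Passing from \<open>fs\<close> to \<open>fs @ [u]\<close>\<close>

lemma rees_map_snoc: "F \<in> poly_ring (length fs) \<Longrightarrow> rees_map (fs @ [u]) F = rees_map fs F"
  by (erule unital_ring_hom_eqI[OF unital_ring_hom_rees_map unital_ring_hom_rees_map])
    (simp_all add: nth_append)

lemma linear_relations_snoc: "ideal_gen (linear_relations fs) \<subseteq> ideal_gen (linear_relations (fs @ [u]))"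
proof (rule ideal_gen_least, rule subsetI)
  fix l assume "l \<in> linear_relations fs"
  then obtain a where a: "l = linear_form (length fs) a" "(\<Sum>i<length fs. a i * fs ! i) = 0"
    by (auto simp: linear_relations_eq)
  have "l = linear_form (length (fs @ [u])) (\<lambda>i. if i < length fs then a i else 0)"
    by (simp add: a linear_form_def)
  also have "\<dots> \<in> ideal_gen (linear_relations (fs @ [u]))"
    by (rule linear_relation_in_ideal) (simp add: nth_append a)
  finally show "l \<in> ideal_gen (linear_relations (fs @ [u]))" .
qed

text \<open>The trivial relation \<open>u * f - f * u = 0\<close> with \<open>f = fs ! j\<close>. It
  trades a factor \<open>u * var j\<close> for a multiple of the new variable.\<close>

lemma koszul_relation:
  assumes "j < length fs"
  shows "const u * var j - const (fs ! j) * var (length fs) \<in> ideal_gen (linear_relations (fs @ [u]))"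
proof -
  let ?a = "\<lambda>i. (if i = j then u else 0) - (if i = length fs then fs ! j else 0)"
  have "linear_form (length (fs @ [u])) ?a \<in> ideal_gen (linear_relations (fs @ [u]))"
    using assms by (intro linear_relation_in_ideal)
      (simp add: left_diff_distrib sum_subtractf sum_delta_mult nth_append mult.commute
        del: sum.lessThan_Suc)
  then show ?thesis
    using assms by (simp add: linear_form_diff linear_form_delta)
qed

lemma rees_kernel_linear_snoc:
  assumes fs: "rees_kernel_linear fs"
  shows "rees_kernel_linear (fs @ [u])"
proof -
  let ?m = "length fs" and ?L = "ideal_gen (linear_relations (fs @ [u]))"
  let ?\<phi> = "rees_map (fs @ [u])"
  have "F \<in> ?L" if "F \<in> poly_ring_below d (Suc ?m)" "?\<phi> F = 0" for d F
    using that
  proof (induction d arbitrary: F)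
    case 0
    then have "keys F = {}" by (auto simp: poly_ring_below_def)
    then show ?case by (simp add: ideal_gen_zero)
  next
    case (Suc d)
    obtain H G where F: "F = H + var ?m * G" and H: "H \<in> poly_ring_below (Suc d) ?m"
      and G: "G \<in> poly_ring_below d (Suc ?m)"
      by (rule poly_ring_below_split_last[OF Suc.prems(1)])
    note H_ring = poly_ring_below_subset[OF H]
    \<comment> \<open>Division does not enlarge the support, so splitting the quotient into a
      constant and multiples of variables leaves cofactors \<open>P j\<close> within the bound
      \<open>d\<close> of the induction hypothesis.\<close>
    have quot: "quotient H \<in> poly_ring_below (Suc d) ?m"
      by (rule keys_subset_in_poly_ring_below[OF H keys_quotient])
    obtain c P where QH: "quotient H = const c + (\<Sum>j<?m. var j * P j)"
      and P: "\<forall>j<?m. P j \<in> poly_ring_below d ?m"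
      by (rule poly_ring_below_split[OF quot])
    have \<phi>_z: "?\<phi> (var ?m) = [:u:] * monom 1 1"
      by (simp add: smult_monom)
    have "rees_map fs H + ?\<phi> (var ?m) * ?\<phi> G = 0"
      using Suc.prems(2) H_ring by (simp only: F rees_map_simps rees_map_snoc)
    \<comment> \<open>The new variable goes to \<open>u\<close> times t, so the image of
      \<open>H\<close> is divisible by \<open>u\<close> and the remainder of \<open>H\<close> lies
      in the kernel for \<open>fs\<close>.\<close>
    then have "rees_map fs H = [:u:] * (- (monom 1 1 * ?\<phi> G))"
      unfolding \<phi>_z by (simp add: eq_neg_iff_add_eq_0 algebra_simps)
    from rees_map_remainder_eq_zero[OF H_ring this] have rem: "remainder H \<in> ?L"
      using fs remainder_in_poly_ring[OF H_ring] linear_relations_snoc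
      by (auto simp: rees_kernel_linear_def)
    have "?\<phi> (remainder H + const u * quotient H + var ?m * G) = 0"
      using Suc.prems(2) by (simp add: F flip: remainder_quotient)
    then have "[:u:] * (?\<phi> (quotient H) + monom 1 1 * ?\<phi> G) = 0"
      using rees_map_linear_relations[OF rem] unfolding rees_map_simps \<phi>_z
      by (simp add: algebra_simps)
    then have QG: "?\<phi> (quotient H) + monom 1 1 * ?\<phi> G = 0"
      by (rule smult_u_eq_zero)
    \<comment> \<open>The cofactor of the new variable after each
      \<open>const u * var j * P j\<close> has been replaced by
      \<open>const (fs ! j) * var ?m * P j\<close>.\<close>
    define F' where "F' = G + (\<Sum>j<?m. const (fs ! j) * P j)"
    have sum_eq: "?\<phi> (\<Sum>j<?m. var j * P j) = monom 1 1 * ?\<phi> (\<Sum>j<?m. const (fs ! j) * P j)"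
    proof -
      have "monom (fs ! j) 1 * p = monom 1 1 * ([:fs ! j:] * p)" for j and p :: "'a poly"
        by (simp add: smult_monom flip: mult_smult_left)
      then show ?thesis
        by (simp add: rees_map_simps sum_distrib_left nth_append del: mult_pCons_left)
    qed
    have "[:c:] + monom 1 1 * ?\<phi> F' = 0"
      using QG unfolding QH F'_def rees_map_simps(2) sum_eq by (simp add: algebra_simps)
    \<comment> \<open>As \<open>monom 1 1\<close> is t, \<open>c\<close> is the constant coefficient
      and the other summand lives in positive degrees; both must vanish.\<close>
    then have cF': "[:c:] + pCons 0 (?\<phi> F') = 0"
      by (simp add: monom_Suc One_nat_def flip: one_pCons)
    then have "c = 0" and "?\<phi> F' = 0"
      by simp_all
    have "F' \<in> poly_ring_below d (Suc ?m)"
      unfolding F'_def using G P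
      by (intro add_in_poly_ring_below sum_in_poly_ring_below const_mult_in_poly_ring_below)
        (auto intro: poly_ring_below_mono[of ?m "Suc ?m"])
    then have F'_L: "F' \<in> ?L" using \<open>?\<phi> F' = 0\<close> by (rule Suc.IH)
    \<comment> \<open>The terms \<open>const (fs ! j) * var ?m * P j\<close> subtracted in the sum
      reappear in \<open>var ?m * F'\<close>.\<close>
    have "F = remainder H + (\<Sum>j<?m. P j * (const u * var j - const (fs ! j) * var ?m)) + var ?m * F'"
    proof -
      have "F = remainder H + const u * quotient H + var ?m * G"
        using F remainder_quotient[of H] by simp
      then show ?thesis
        by (simp add: QH \<open>c = 0\<close> F'_def sum_distrib_left sum_subtractf algebra_simps)
    qed
    moreover have "(\<Sum>j<?m. P j * (const u * var j - const (fs ! j) * var ?m)) \<in> ?L"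
      by (intro ideal_gen_sum ideal_gen_mult koszul_relation) auto
    ultimately show ?case
      using rem F'_L by (simp add: ideal_gen_add ideal_gen_mult)
  qed
  moreover have "\<exists>d. F \<in> poly_ring_below d (Suc ?m)" if "F \<in> poly_ring (Suc ?m)" for F :: "(nat, 'a) mpoly"
  proof -
    have "finite (total_degree ` keys F)" by simp
    then obtain d where "\<forall>n\<in>total_degree ` keys F. n < d"
      using finite_nat_set_iff_bounded by blast
    then show ?thesis using that by (auto simp: poly_ring_below_def)
  qed
  ultimately show ?thesis
    unfolding rees_kernel_linear_def length_append_singleton by blast
qed

section \<open>Passing from \<open>fs @ [u]\<close> back to \<open>fs\<close>\<close>

lemma remainder_mult_linear_form:
  assumes "(\<Sum>i<length fs. a i * fs ! i) = u * b"
  shows "remainder (r * linear_form (length fs) a) \<in> ideal_gen (linear_relations fs)"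
proof (induction r rule: poly_mapping_single_induct)
  case zero
  show ?case by (simp add: ideal_gen_zero)
next
  case (single e c)
  \<comment> \<open>The factor \<open>c\<close> stays inside \<nu>, which need not be linear over
    the whole ring. The new coefficients form a relation of \<open>fs\<close>, since their value is
    \<nu> of a multiple of \<open>u\<close>.\<close>
  have "remainder (single e c * linear_form (length fs) a) =
      single e 1 * linear_form (length fs) (\<lambda>i. \<nu> (c * a i))"
  proof -
    have "single e c * (const (a i) * var i) = single (e + single i 1) (c * a i)"
      and "single e 1 * (const (\<nu> (c * a i)) * var i) = single (e + single i 1) (\<nu> (c * a i))" for i
      by (simp_all add: const_def var_def mult_single)
    moreover have "remainder (\<Sum>i\<in>S. f i) = (\<Sum>i\<in>S. remainder (f i))"
      for S :: "nat set" and f :: "nat \<Rightarrow> (nat, 'a) mpoly"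
      by (rule poly_mapping_eqI) (simp add: lookup_sum \<nu>_sum)
    ultimately show ?thesis
      by (simp add: linear_form_def sum_distrib_left)
  qed
  moreover have "(\<Sum>i<length fs. \<nu> (c * a i) * fs ! i) = 0"
  proof -
    have "(\<Sum>i<length fs. \<nu> (c * a i) * fs ! i) = \<nu> (\<Sum>i<length fs. c * a i * fs ! i)"
      by (simp add: \<nu>_sum \<nu>_mult_gen)
    also have "(\<Sum>i<length fs. c * a i * fs ! i) = u * (c * b)"
      using assms by (simp add: mult.assoc mult.left_commute flip: sum_distrib_left)
    finally show ?thesis by (simp add: \<nu>_mult_u)
  qed
  ultimately show ?case
    by (simp add: ideal_gen_mult linear_relation_in_ideal)
qed (simp add: distrib_right remainder_add ideal_gen_add)

text \<open>Induction on the number of divisions by \<open>u\<close> that bring every coefficient of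
  \<open>F\<close> to 0. The hypothesis \<open>nilpotent\<close> provides this number for one
  coefficient, and finite support makes it uniform.\<close>

lemma rees_kernel_linear_butlast:
  assumes fsu: "rees_kernel_linear (fs @ [u])"
    and nilpotent: "\<And>x. \<exists>n. (q ^^ n) x = 0"
  shows "rees_kernel_linear fs"
proof -
  let ?m = "length fs" and ?L = "ideal_gen (linear_relations fs)"
  have q_funpow_zero: "(q ^^ n) 0 = 0" for n
    by (induction n) simp_all
  \<comment> \<open>Besides the variable of \<open>u\<close>, all later ones are sent to 0, because
    the multipliers in \<open>ideal_gen\<close> range over the ambient ring.\<close>
  let ?\<zeta> = "substitute (\<lambda>j. if j < ?m then var j else 0)"
  have remainder_L: "remainder (?\<zeta> F) \<in> ?L" if "F \<in> ideal_gen (linear_relations (fs @ [u]))" for F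
    using that
  proof (induction rule: ideal_gen_induct)
    case zero
    show ?case by (simp add: substitute_simps ideal_gen_zero)
  next
    case (add r l F)
    then obtain a where l: "l = linear_form (Suc ?m) a" and "(\<Sum>i<Suc ?m. a i * (fs @ [u]) ! i) = 0"
      by (auto simp: linear_relations_eq)
    \<comment> \<open>With the contribution of \<open>u\<close> moved to the right, the truncated
      form is a relation of \<open>fs\<close> modulo \<open>u\<close>.\<close>
    then have "(\<Sum>i<?m. a i * fs ! i) = u * (- a ?m)"
      by (simp add: nth_append eq_neg_iff_add_eq_0 mult.commute)
    note remainder_mult_linear_form[OF this]
    moreover have "?\<zeta> l = linear_form ?m a"
      by (simp add: l linear_form_def substitute_simps)
    ultimately show ?case
      using add.IH by (simp add: substitute_simps remainder_add ideal_gen_add)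
  qed
  have "F \<in> ?L"
    if "\<And>e. (q ^^ n) (lookup F e) = 0" "F \<in> poly_ring ?m" "rees_map fs F = 0" for n F
    using that
  proof (induction n arbitrary: F)
    case 0
    then have "F = 0" by (intro poly_mapping_eqI) simp
    then show ?case by (simp add: ideal_gen_zero)
  next
    case (Suc n)
    have rem: "remainder F \<in> poly_ring ?m" "rees_map fs (remainder F) = 0"
      using Suc.prems rees_map_remainder_eq_zero[of F 0] by (simp_all add: remainder_in_poly_ring)
    then have "remainder F \<in> ideal_gen (linear_relations (fs @ [u]))"
      using fsu poly_ring_mono[of ?m "Suc ?m"]
      by (auto simp: rees_kernel_linear_def rees_map_snoc)
    \<comment> \<open>Neither the substitution nor a second remainder changes
      \<open>remainder F\<close>.\<close>
    from remainder_L[OF this] have 1: "remainder F \<in> ?L"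
      using substitute_eq_self[OF rem(1), of "\<lambda>j. if j < ?m then var j else 0"] by simp
    have "rees_map fs (remainder F + const u * quotient F) = 0"
      using Suc.prems(3) by (simp flip: remainder_quotient)
    then have "[:u:] * rees_map fs (quotient F) = 0"
      by (simp only: rees_map_simps rem(2) rees_map_const add_0_left)
    then have "rees_map fs (quotient F) = 0"
      by (rule smult_u_eq_zero)
    moreover have "(q ^^ n) (lookup (quotient F) e) = 0" for e
      using Suc.prems(1)[of e] by (simp add: funpow_swap1)
    ultimately have "quotient F \<in> ?L"
      using Suc.IH quotient_in_poly_ring[OF Suc.prems(2)] by blast
    then show ?case
      using 1 remainder_quotient[of F] by (metis ideal_gen_add ideal_gen_mult)
  qed
  moreover have "\<exists>n. \<forall>e. (q ^^ n) (lookup F e) = 0" for F :: "(nat, 'a) mpoly"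
  proof -
    obtain n where n: "\<And>x. (q ^^ n x) x = 0" using nilpotent by metis
    \<comment> \<open>The inserted 0 covers an empty support; divisions beyond the necessary number
      keep the value 0.\<close>
    have "(q ^^ Max (insert 0 ((\<lambda>e. n (lookup F e)) ` keys F))) (lookup F e) = 0" (is "(q ^^ ?N) _ = 0") for e
    proof (cases "e \<in> keys F")
      case True
      then have "n (lookup F e) \<le> ?N" by (intro Max_ge) auto
      then obtain k where "?N = k + n (lookup F e)" by (metis le_add_diff_inverse2)
      then show ?thesis by (simp add: funpow_add n q_funpow_zero)
    qed (simp add: in_keys_iff q_funpow_zero)
    then show ?thesis by blast
  qed
  ultimately show ?thesis
    unfolding rees_kernel_linear_def by blast
qed

end

section \<open>Monomials\<close>

text \<open>Divisibility of monomials, expressed on exponent vectors.\<close>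

definition exponent_le :: "('v \<Rightarrow>\<^sub>0 nat) \<Rightarrow> ('v \<Rightarrow>\<^sub>0 nat) \<Rightarrow> bool" where
  "exponent_le e a \<longleftrightarrow> (\<forall>x. lookup e x \<le> lookup a x)"

lemma exponent_le_add: "exponent_le e (e + a)"
  by (simp add: exponent_le_def lookup_add)

lemma exponent_le_add_diff: "exponent_le e a \<Longrightarrow> e + (a - e) = a"
  by (rule poly_mapping_eqI) (simp add: exponent_le_def lookup_add lookup_minus)

lemma single_eq_mult_single:
  fixes c :: "'k::comm_ring_1"
  assumes "exponent_le e a"
  shows "single a c = single (a - e) c * single e 1"
  using exponent_le_add_diff[OF assms] by (subst mult.commute) (simp add: mult_single)

lemma exists_lookup_pos:
  fixes e :: "'v \<Rightarrow>\<^sub>0 nat"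
  assumes "e \<noteq> 0"
  obtains x where "lookup e x > 0"
  using assms by (auto simp: poly_mapping_eq_iff fun_eq_iff)

lemma lookup_single_mult:
  fixes p :: "('v, 'k::comm_ring_1) mpoly"
  shows "lookup (single e 1 * p) a = (if exponent_le e a then lookup p (a - e) else 0)"
proof (induction p rule: poly_mapping_single_induct)
  case (single k c)
  have "e + k = a \<longleftrightarrow> exponent_le e a \<and> k = a - e"
    using exponent_le_add exponent_le_add_diff by fastforce
  then show ?case by (auto simp: mult_single lookup_single when_def)
qed (simp_all add: distrib_left lookup_add)

definition monomial_remainder :: "('v \<Rightarrow>\<^sub>0 nat) \<Rightarrow> ('v, 'k::comm_ring_1) mpoly \<Rightarrow> ('v, 'k) mpoly" where
  "monomial_remainder e = Poly_Mapping.mapp (\<lambda>a c. if exponent_le e a then 0 else c)"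

text \<open>Reading coefficients at shifted exponents divides the multiples of
  \<open>single e 1\<close> and discards all other terms; the shift is injective, as
  \<open>map_key\<close> requires.\<close>

definition monomial_quotient :: "('v \<Rightarrow>\<^sub>0 nat) \<Rightarrow> ('v, 'k::comm_ring_1) mpoly \<Rightarrow> ('v, 'k) mpoly" where
  "monomial_quotient e = Poly_Mapping.map_key (\<lambda>a. e + a)"

lemma lookup_monomial_remainder:
  "lookup (monomial_remainder e p) a = (if exponent_le e a then 0 else lookup p a)"
  by (simp add: monomial_remainder_def lookup_mapp when_def in_keys_iff)

lemma lookup_monomial_quotient: "lookup (monomial_quotient e p) a = lookup p (e + a)"
  by (simp add: monomial_quotient_def Poly_Mapping.map_key.rep_eq)

lemma linear_splitting_monomial:
  fixes fs :: "('v, 'k::comm_ring_1) mpoly list"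
  assumes "\<And>f. f \<in> set fs \<Longrightarrow> \<exists>g. f = single g 1 \<and> keys g \<inter> keys e = {}"
  shows "linear_splitting fs (single e 1) (monomial_remainder e) (monomial_quotient e)"
proof
  fix x y :: "('v, 'k) mpoly"
  show "monomial_remainder e (x + y) = monomial_remainder e x + monomial_remainder e y"
    by (rule poly_mapping_eqI) (simp add: lookup_monomial_remainder lookup_add)
  show "x = monomial_remainder e x + single e 1 * monomial_quotient e x"
    by (rule poly_mapping_eqI)
      (simp add: lookup_monomial_remainder lookup_monomial_quotient lookup_add lookup_single_mult
        exponent_le_add_diff)
  show "monomial_remainder e (single e 1 * x) = 0"
    by (rule poly_mapping_eqI) (simp add: lookup_monomial_remainder lookup_single_mult)
  show "x = 0" if "single e 1 * x = 0"
  proof (rule poly_mapping_eqI)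
    fix a
    have "lookup x a = lookup (single e 1 * x) (e + a)"
      by (simp add: lookup_single_mult exponent_le_add)
    then show "lookup x a = lookup 0 a" by (simp add: that)
  qed
next
  fix f x :: "('v, 'k) mpoly"
  assume "f \<in> set fs"
  then obtain g where f: "f = single g 1" and disjoint: "keys g \<inter> keys e = {}"
    using assms by blast
  \<comment> \<open>Removing the factor with exponent \<open>g\<close> does not affect divisibility
    by the monomial of \<open>e\<close>: at each variable, one of the two exponents is 0.\<close>
  have "exponent_le e a \<longleftrightarrow> exponent_le e (a - g)" if "exponent_le g a" for a
    unfolding exponent_le_def lookup_minus
  proof (rule all_cong1)
    fix x
    have "lookup e x = 0 \<or> lookup g x = 0"
      using disjoint by (auto simp: in_keys_iff disjoint_iff)
    then show "lookup e x \<le> lookup a x \<longleftrightarrow> lookup e x \<le> lookup a x - lookup g x"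
      by auto
  qed
  then have "monomial_remainder e (single g 1 * x) = single g 1 * monomial_remainder e x"
    by (intro poly_mapping_eqI) (simp add: lookup_monomial_remainder lookup_single_mult)
  then show "monomial_remainder e (x * f) = monomial_remainder e x * f"
    by (simp add: f mult.commute)
qed

text \<open>Each division lowers the exponent of a variable \<open>x\<close> occurring in
  \<open>e\<close>, and these exponents are bounded on the support of \<open>p\<close>.\<close>

lemma monomial_quotient_nilpotent:
  fixes p :: "('v, 'k::comm_ring_1) mpoly"
  assumes "e \<noteq> 0"
  shows "\<exists>n. (monomial_quotient e ^^ n) p = 0"
proof -
  obtain x where x: "lookup e x > 0"
    using assms by (rule exists_lookup_pos)
  have vanish: "(monomial_quotient e ^^ n) p = 0" if "\<And>a. a \<in> keys p \<Longrightarrow> lookup a x < n"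
    for n and p :: "('v, 'k) mpoly"
    using that
  proof (induction n arbitrary: p)
    case 0
    then have "keys p = {}" by blast
    then show ?case by simp
  next
    case (Suc n)
    have "lookup a x < n" if "a \<in> keys (monomial_quotient e p)" for a
      using Suc.prems[of "e + a"] that x
      by (simp add: in_keys_iff lookup_monomial_quotient lookup_add)
    then show ?case by (simp add: Suc.IH funpow_swap1)
  qed
  have "finite ((\<lambda>a. lookup a x) ` keys p)" by simp
  then obtain n where "\<forall>k\<in>(\<lambda>a. lookup a x) ` keys p. k < n"
    using finite_nat_set_iff_bounded by blast
  then show ?thesis using vanish[of p n] by auto
qed

section \<open>Monomial generators coprime to \<open>u\<close>\<close>

lemma monomial_ideal_coprime_generators:
  fixes I :: "('v, 'k::field) mpoly set"
  assumes I: "monomial_ideal I" and regular: "nonzerodivisor_mod I (single e 1)"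
  shows "I = ideal_gen {single g 1 | g. single g 1 \<in> I \<and> keys g \<inter> keys e = {}}" (is "I = ideal_gen ?M")
proof
  obtain M where M: "\<forall>v\<in>M. is_monomial v" "I = ideal_gen M"
    using I by (auto simp: monomial_ideal_def)
  have "?M \<subseteq> ideal_gen M" using M(2) by auto
  then show "ideal_gen ?M \<subseteq> I" unfolding M(2) by (rule ideal_gen_least)
  have power: "p \<in> I" if "single e 1 ^ n * p \<in> I" for n p
    using that
  proof (induction n arbitrary: p)
    case (Suc n)
    then have "single e 1 * (single e 1 ^ n * p) \<in> I" by (simp add: mult.assoc)
    then have "single e 1 ^ n * p \<in> I"
      using regular unfolding nonzerodivisor_mod_def by blast
    then show ?case by (rule Suc.IH)
  qed simp
  have single_power: "\<exists>k. single e 1 ^ n = single k (1::'k) \<and> (\<forall>x. lookup k x = n * lookup e x)" for n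
  proof (induction n)
    case 0
    show ?case by (intro exI[of _ 0]) simp
  next
    case (Suc n)
    then obtain k where "single e 1 ^ n = single k (1::'k)" "\<forall>x. lookup k x = n * lookup e x" by blast
    then show ?case by (intro exI[of _ "e + k"]) (simp add: mult_single lookup_add)
  qed
  have "M \<subseteq> ideal_gen ?M"
  proof
    fix v assume "v \<in> M"
    then obtain a where a: "v = single a 1" and "single a 1 \<in> I"
      using M ideal_gen_base[of _ M] by (auto simp: is_monomial_def)
    \<comment> \<open>\<open>g\<close> is \<open>a\<close> with the variables of \<open>e\<close>
      stripped. A high power of \<open>single e 1\<close> restores them, so that the product lies in
      \<open>I\<close>; regularity then cancels the power.\<close>
    define g where "g = Poly_Mapping.mapp (\<lambda>x c. if x \<in> keys e then 0 else c) a"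
    have g: "lookup g x = (if x \<in> keys e then 0 else lookup a x)" for x
      by (simp add: g_def lookup_mapp when_def in_keys_iff)
    \<comment> \<open>The total degree of \<open>a\<close> suffices as the power: it bounds every
      exponent of \<open>a\<close>, and \<open>e\<close> is at least 1 at each of its
      variables.\<close>
    obtain k where k: "single e 1 ^ total_degree a = single k (1::'k)"
      "\<And>x. lookup k x = total_degree a * lookup e x"
      using single_power by blast
    have "exponent_le a (k + g)"
      unfolding exponent_le_def
    proof
      fix x
      have "lookup a x \<le> total_degree a"
        by (cases "x \<in> keys a")
          (auto simp: total_degree_def in_keys_iff intro: member_le_sum[of x "keys a" "lookup a"])
      moreover have "1 \<le> lookup e x" if "x \<in> keys e"
        using that by (simp add: in_keys_iff)
      ultimately show "lookup a x \<le> lookup (k + g) x"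
        using mult_le_mono[of "lookup a x" "total_degree a" 1 "lookup e x"]
        by (cases "x \<in> keys e") (simp_all add: lookup_add k(2) g)
    qed
    then have "single (k + g) 1 = single (k + g - a) 1 * single a (1::'k)"
      by (rule single_eq_mult_single)
    moreover have "single (k + g - a) 1 * single a 1 \<in> I"
      using \<open>single a 1 \<in> I\<close> unfolding M(2) by (rule ideal_gen_mult)
    ultimately have "single e 1 ^ total_degree a * single g 1 \<in> I"
      by (simp only: k(1) mult_single mult_1_left)
    then have "single g 1 \<in> I" by (rule power)
    moreover have "keys g \<inter> keys e = {}" by (auto simp: in_keys_iff g)
    ultimately have "single g 1 \<in> ?M" by blast
    then have "single (a - g) 1 * single g 1 \<in> ideal_gen ?M"
      by (rule ideal_gen_mult[OF ideal_gen_base])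
    moreover have "exponent_le g a" by (simp add: exponent_le_def g)
    then have "v = single (a - g) 1 * single g 1"
      unfolding a by (rule single_eq_mult_single)
    ultimately show "v \<in> ideal_gen ?M" by simp
  qed
  then show "I \<subseteq> ideal_gen ?M" unfolding M(2) by (rule ideal_gen_least)
qed

text \<open>Finite generation descends from \<open>(I, u)\<close> to \<open>I\<close>: finitely many
  of the coprime monomials generate \<open>(I, u)\<close> together with \<open>u\<close>, and taking
  remainders shows that they generate \<open>I\<close> alone.\<close>

lemma monomial_ideal_finite_coprime_generators:
  fixes I :: "('v, 'k::field) mpoly set"
  assumes I: "monomial_ideal I" and regular: "nonzerodivisor_mod I (single e 1)" and "e \<noteq> 0"
    and gs: "ideal_gen (insert (single e 1) I) = ideal_gen (set gs)"
  obtains fs where "I = ideal_gen (set fs)" "\<And>f. f \<in> set fs \<Longrightarrow> \<exists>g. f = single g 1 \<and> keys g \<inter> keys e = {}"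
proof -
  define M where "M = {single g (1::'k) | g. single g 1 \<in> I \<and> keys g \<inter> keys e = {}}"
  have IM: "I = ideal_gen M"
    unfolding M_def by (rule monomial_ideal_coprime_generators[OF I regular])
  have "insert (single e 1) I \<subseteq> ideal_gen (insert (single e 1) M)"
    using ideal_gen_base[of "single e 1" "insert (single e 1) M"] ideal_gen_mono[of M "insert (single e 1) M"] IM
    by auto
  then have "ideal_gen (set gs) \<subseteq> ideal_gen (insert (single e 1) M)"
    unfolding gs[symmetric] by (rule ideal_gen_least)
  then have "set gs \<subseteq> ideal_gen (insert (single e 1) M)"
    using ideal_gen_base[of _ "set gs"] by blast
  from ideal_gen_finite_subset[OF finite_set this]
  obtain S where S: "finite S" "S \<subseteq> insert (single e 1) M" "set gs \<subseteq> ideal_gen S" by blast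
  obtain fs where fs: "set fs = S - {single e 1}"
    using S(1) by (metis finite_Diff finite_list)
  have fs_M: "set fs \<subseteq> M" using S(2) fs by auto
  then have coprime: "\<exists>g. f = single g 1 \<and> keys g \<inter> keys e = {}" if "f \<in> set fs" for f
    using that by (auto simp: M_def)
  interpret linear_splitting fs "single e 1" "monomial_remainder e" "monomial_quotient e"
    by (rule linear_splitting_monomial) (rule coprime)
  have "M \<subseteq> ideal_gen (set fs)"
  proof
    fix p assume p: "p \<in> M"
    then obtain g where g: "p = single g 1" "keys g \<inter> keys e = {}" by (auto simp: M_def)
    \<comment> \<open>A variable of \<open>e\<close> is missing from \<open>g\<close>, hence
      \<open>p\<close> is not divisible by the monomial of \<open>e\<close> and equals its own
      remainder.\<close>
    obtain x where x: "lookup e x > 0"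
      using \<open>e \<noteq> 0\<close> by (rule exists_lookup_pos)
    then have "lookup g x = 0"
      using g(2) by (auto simp: in_keys_iff disjoint_iff)
    with x have "\<not> exponent_le e g"
      by (auto simp: exponent_le_def intro!: exI[of _ x])
    then have remainder_p: "monomial_remainder e p = p"
      by (intro poly_mapping_eqI) (auto simp: lookup_monomial_remainder g(1) lookup_single when_def)
    have "p \<in> ideal_gen (insert (single e 1) I)"
      using p IM ideal_gen_base by blast
    also have "\<dots> \<subseteq> ideal_gen S"
      unfolding gs using S(3) by (rule ideal_gen_least)
    also have "\<dots> \<subseteq> ideal_gen (insert (single e 1) (set fs))"
      by (rule ideal_gen_mono) (auto simp: fs)
    finally show "p \<in> ideal_gen (set fs)"
      using \<nu>_ideal_gen remainder_p by metis
  qed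
  then have "I = ideal_gen (set fs)"
    using IM fs_M ideal_gen_least ideal_gen_mono by blast
  then show thesis using coprime that by blast
qed

section \<open>The equivalence for monomial ideals\<close>

theorem corollary2p2:
  fixes I :: "('x::finite, 'k::field) mpoly set"
    and u :: "('x, 'k) mpoly"
  assumes "monomial_ideal I"
    and "is_monomial u"
    and "u \<noteq> 1"
    and "nonzerodivisor_mod I u"
  shows "linear_type I \<longleftrightarrow> linear_type (ideal_gen (insert u I))"
proof -
  obtain e where u: "u = single e 1" using assms(2) by (auto simp: is_monomial_def)
  \<comment> \<open>A nonzero exponent makes iterated division by \<open>u\<close> terminate. For
    \<open>u = 1\<close> the larger ideal would be the whole ring, which is of linear type whatever
    \<open>I\<close> is.\<close>
  with assms(3) have e: "e \<noteq> 0" by (auto simp flip: single_one)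
  have insert_gen: "ideal_gen (insert u (ideal_gen (set fs))) = ideal_gen (set (fs @ [u]))" for fs
  proof
    have "insert u (ideal_gen (set fs)) \<subseteq> ideal_gen (set (fs @ [u]))"
      using ideal_gen_base[of u "set (fs @ [u])"] ideal_gen_mono[of "set fs" "set (fs @ [u])"] by auto
    then show "ideal_gen (insert u (ideal_gen (set fs))) \<subseteq> ideal_gen (set (fs @ [u]))"
      by (rule ideal_gen_least)
    show "ideal_gen (set (fs @ [u])) \<subseteq> ideal_gen (insert u (ideal_gen (set fs)))"
      using ideal_gen_base[of _ "set fs"] by (intro ideal_gen_mono) auto
  qed
  show ?thesis
  proof (cases "\<exists>gs. ideal_gen (insert u I) = ideal_gen (set gs)")
    case True
    then obtain fs where I: "I = ideal_gen (set fs)"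
      and coprime: "\<And>f. f \<in> set fs \<Longrightarrow> \<exists>g. f = single g 1 \<and> keys g \<inter> keys e = {}"
      using monomial_ideal_finite_coprime_generators[OF assms(1) assms(4)[unfolded u] e] u by metis
    interpret linear_splitting fs u "monomial_remainder e" "monomial_quotient e"
      unfolding u by (rule linear_splitting_monomial) (rule coprime)
    have "rees_kernel_linear fs \<longleftrightarrow> rees_kernel_linear (fs @ [u])"
      using rees_kernel_linear_snoc rees_kernel_linear_butlast monomial_quotient_nilpotent[OF e] by blast
    then show ?thesis
      by (simp only: I insert_gen linear_type_iff_rees_kernel_linear)
  next
    case False
    \<comment> \<open>\<open>linear_type\<close> includes finite generation. A finite list for
      \<open>I\<close> would give one for the larger ideal by appending \<open>u\<close>, so both
      sides are false.\<close>
    then have "\<not> linear_type (ideal_gen (insert u I))" "\<not> linear_type I"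
      using insert_gen unfolding linear_type_def by blast+
    then show ?thesis by blast
  qed
qed

end
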